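(* Let $G$ be a finite connected graph. Then, for each labeling $l\colon V(G)\to\mathbb{R}^+$, we have the inequality \[ |D(V(G))|\le|E(G)|+1, \] where $D(V(G))$ is the distance set of the pseudoultrametric space $(V(G),d_l)$ with $d_l\colon V(G)\times V(G)\to\mathbb{R}^+$ generated by $G(l)$. Moreover, the following statements are equivalent: (i) There is a labeling $l\colon V(G)\to\mathbb{R}^+$ such that $|D(V(G))|=|E(G)|+1$. (ii) The graph $G$ is a tree.
   Context: $\mathbb{R}^+:=[0,\infty)$. A graph $G$ is a pair $(V,E)$ with $V=V(G)$ a non-empty set and $E=E(G)$ a (possibly empty) set of unordered pairs of distinct elements of $V$. A graph is finite if it has finitely many vertices. A path is a graph with vertex set $\{x_0,\dots,x_k\}$, all $x_i$ distinct, $k\ge 1$, and edge set $\{\{x_0,x_1\},\dots,\{x_{k-1},x_k\}\}$; it joins $x_0$ and $x_k$. $G$ is connected if any two distinct vertices are joined by a path contained in $G$ (one-vertex graphs are connected). A tree is a connected graph without cycles. A labeled graph $G(l)$ is a graph $G$ together with a labeling $l\colon V(G)\to\mathbb{R}^+$. For a connected labeled graph $G(l)$, the mapping $d_l\colon V(G)\times V(G)\to\mathbb{R}^+$ generated by $G(l)$ is \[ d_l(x,y):=\begin{cases}0,& x=y,\\ \inf\limits_{P\in\mathcal{P}_{x,y}}\Big(\max\limits_{v\in V(P)}l(v)\Big),& x\ne y,\end{cases} \] where $\mathcal{P}_{x,y}$ is the set of all paths joining $x$ and $y$ in $G$. It is a pseudoultrametric: symmetric, $d_l(x,x)=0$,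 and $d_l(x,y)\le\max\{d_l(x,z),d_l(z,y)\}$. The distance set of $(V(G),d_l)$ is $D(V(G)):=\{d_l(x,y):x,y\in V(G)\}$ (it contains $0$). *)

theory Defs
  imports Complex_Main "HOL-Library.FuncSet"
begin

text \<open>Simple graphs as pairs of a vertex set and a set of two-element vertex sets.\<close>

type_synonym 'a graph = "'a set \<times> 'a set set"

abbreviation vertices :: "'a graph \<Rightarrow> 'a set" where
  "vertices G \<equiv> fst G"

abbreviation edges :: "'a graph \<Rightarrow> 'a set set" where
  "edges G \<equiv> snd G"

definition is_graph :: "'a graph \<Rightarrow> bool" where
  "is_graph G \<longleftrightarrow>
     vertices G \<noteq> {} \<and>
     edges G \<subseteq> {{x, y} | x y. x \<in> vertices G \<and> y \<in> vertices G \<and> x \<noteq> y}"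

definition subgraph :: "'a graph \<Rightarrow> 'a graph \<Rightarrow> bool" where
  "subgraph H G \<longleftrightarrow> vertices H \<subseteq> vertices G \<and> edges H \<subseteq> edges G"

text \<open>The path enumerated by \<open>[x\<^sub>0, \<dots>, x\<^sub>k]\<close>; a length of at least 2 means \<open>k \<ge> 1\<close>.\<close>

definition path_joining :: "'a graph \<Rightarrow> 'a \<Rightarrow> 'a \<Rightarrow> bool" where
  "path_joining P x y \<longleftrightarrow>
     (\<exists>xs. distinct xs \<and> 2 \<le> length xs \<and> hd xs = x \<and> last xs = y \<and>
        vertices P = set xs \<and>
        edges P = {{xs ! i, xs ! Suc i} | i. Suc i < length xs})"

definition paths_between :: "'a graph \<Rightarrow> 'a \<Rightarrow> 'a \<Rightarrow> 'a graph set" where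
  "paths_between G x y = {P. path_joining P x y \<and> subgraph P G}"

definition connected_graph :: "'a graph \<Rightarrow> bool" where
  "connected_graph G \<longleftrightarrow>
     is_graph G \<and>
     (\<forall>x\<in>vertices G. \<forall>y\<in>vertices G. x \<noteq> y \<longrightarrow> paths_between G x y \<noteq> {})"

definition is_cycle :: "'a graph \<Rightarrow> bool" where
  "is_cycle C \<longleftrightarrow>
     (\<exists>xs. distinct xs \<and> 3 \<le> length xs \<and>
        vertices C = set xs \<and>
        edges C = {{xs ! i, xs ! Suc i} | i. Suc i < length xs} \<union> {{last xs, hd xs}})"

definition is_tree :: "'a graph \<Rightarrow> bool" where
  "is_tree G \<longleftrightarrow> connected_graph G \<and> \<not> (\<exists>C. is_cycle C \<and> subgraph C G)"

text \<open>
  A labeling is a total function of which only the values on the vertices matter.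
\<close>

definition labelings :: "'a graph \<Rightarrow> ('a \<Rightarrow> real) set" where
  "labelings G = vertices G \<rightarrow> {0..}"

text \<open>
  Intended for connected \<open>G\<close> and vertices \<open>x\<close>, \<open>y\<close> of \<open>G\<close>: then the infimum is
  over a nonempty set of reals bounded below by 0 (otherwise it is unspecified).
\<close>

definition label_dist :: "'a graph \<Rightarrow> ('a \<Rightarrow> real) \<Rightarrow> 'a \<Rightarrow> 'a \<Rightarrow> real" where
  "label_dist G l x y =
     (if x = y then 0 else INF P\<in>paths_between G x y. Max (l ` vertices P))"

definition distance_set :: "'a graph \<Rightarrow> ('a \<Rightarrow> real) \<Rightarrow> real set" where
  "distance_set G l = {label_dist G l x y | x y. x \<in> vertices G \<and> y \<in> vertices G}"

end

theory Submission
  imports Defs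
begin

text \<open>
  Weight each edge by the larger label of its ends. The maximal label on a path is the weight of
  one of its edges, and adjacent vertices are at distance the weight of their edge, so the distance
  set is exactly \<open>0\<close> together with the set of edge weights. Hence equality in the bound means that
  the weights are positive and pairwise distinct. This excludes cycles, because the two cycle edges
  at a vertex of maximal label have the same weight. Conversely, in an acyclic graph remove a vertex
  of degree at most 1, label the rest recursively, and give that vertex the largest label.
\<close>

section \<open>Edge weights and the distance set\<close>

definition edge_weight :: "('a \<Rightarrow> real) \<Rightarrow> 'a set \<Rightarrow> real" where
  "edge_weight l e = Max (l ` e)"

lemma edge_weight_doubleton [simp]: "edge_weight l {x, y} = max (l x) (l y)"
  by (simp add: edge_weight_def)

lemma is_graph_edgeE:
  assumes "is_graph G" "e \<in> edges G"
  obtains x y where "e = {x, y}" "x \<in> vertices G" "y \<in> vertices G" "x \<noteq> y"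
  using assms unfolding is_graph_def by blast

lemma finite_edges:
  assumes "is_graph G" "finite (vertices G)"
  shows "finite (edges G)"
proof (rule finite_subset)
  show "edges G \<subseteq> Pow (vertices G)"
    using assms(1) by (auto elim: is_graph_edgeE)
qed (use assms(2) in simp)

text \<open>A vertex of maximal label lies on some edge of the path, since a path has at least two
  vertices; the other end of that edge has no larger label.\<close>

lemma path_Max_is_edge_weight:
  assumes "P \<in> paths_between G x y"
  shows "Max (l ` vertices P) \<in> edge_weight l ` edges G"
proof -
  obtain xs where xs: "2 \<le> length xs" "vertices P = set xs"
      "edges P = {{xs ! i, xs ! Suc i} | i. Suc i < length xs}"
    and sub: "edges P \<subseteq> edges G"
    using assms unfolding paths_between_def path_joining_def subgraph_def by blast
  have "Max (l ` set xs) \<in> l ` set xs"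
    using xs(1) by (intro Max_in) auto
  then obtain i where i: "i < length xs" "l (xs ! i) = Max (l ` set xs)"
    by (auto simp: in_set_conv_nth)
  \<comment> \<open>The last vertex has no successor on the path, so there the preceding edge is
    taken.\<close>
  define j where "j = (if Suc i < length xs then i else i - 1)"
  have j: "Suc j < length xs" "i = j \<or> i = Suc j"
    using i(1) xs(1) by (auto simp: j_def)
  have le: "l (xs ! k) \<le> Max (l ` set xs)" if "k < length xs" for k
    using that by simp
  have "edge_weight l {xs ! j, xs ! Suc j} = Max (l ` set xs)"
    using j i(2) le[of j] le[of "Suc j"] by auto
  moreover have "{xs ! j, xs ! Suc j} \<in> edges G"
    using j(1) xs(3) sub by blast
  ultimately show ?thesis
    using xs(2) by (metis imageI)
qed

text \<open>The infimum is over a nonempty subset of the finite set of edge weights, so it is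
  attained.\<close>

lemma label_dist_in_edge_weights:
  assumes "finite (edges G)" "paths_between G x y \<noteq> {}" "x \<noteq> y"
  shows "label_dist G l x y \<in> edge_weight l ` edges G"
proof -
  let ?S = "(\<lambda>P. Max (l ` vertices P)) ` paths_between G x y"
  have sub: "?S \<subseteq> edge_weight l ` edges G"
    by (intro image_subsetI path_Max_is_edge_weight)
  then have fin: "finite ?S"
    using assms(1) finite_subset by blast
  have "Inf ?S \<in> ?S"
    using fin assms(2) by (simp add: cInf_eq_Min)
  then show ?thesis
    using sub assms(3) by (auto simp: label_dist_def)
qed

text \<open>The one-edge path attains the weight, and every path from \<open>x\<close> to
  \<open>y\<close> contains both ends, so none does better.\<close>

lemma label_dist_adjacent:
  assumes "is_graph G" "{x, y} \<in> edges G" "x \<noteq> y"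
  shows "label_dist G l x y = edge_weight l {x, y}"
proof -
  let ?S = "(\<lambda>P. Max (l ` vertices P)) ` paths_between G x y"
  have "path_joining ({x, y}, {{x, y}}) x y"
    unfolding path_joining_def using assms(3) by (intro exI[of _ "[x, y]"]) auto
  moreover have "{x, y} \<subseteq> vertices G"
    using assms(1,2) by (metis is_graph_edgeE empty_subsetI insert_subset)
  then have "subgraph ({x, y}, {{x, y}}) G"
    using assms(2) by (simp add: subgraph_def)
  ultimately have "edge_weight l {x, y} \<in> ?S"
    unfolding paths_between_def edge_weight_def by force
  moreover have "edge_weight l {x, y} \<le> m" if mS: "m \<in> ?S" for m
  proof -
    obtain P where m: "m = Max (l ` vertices P)" and "P \<in> paths_between G x y"
      using mS by blast
    then obtain xs where xs: "2 \<le> length xs" "hd xs = x" "last xs = y" "vertices P = set xs"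
      unfolding paths_between_def path_joining_def by blast
    then have "xs \<noteq> []"
      by auto
    then have "x \<in> set xs" "y \<in> set xs"
      using xs hd_in_set last_in_set by blast+
    then show ?thesis
      using m xs(4) by simp
  qed
  ultimately have "Inf ?S = edge_weight l {x, y}"
    by (rule cInf_eq_minimum)
  then show ?thesis
    using assms(3) by (simp add: label_dist_def)
qed

text \<open>Turns counting distances into counting edge weights; connectedness ensures that no
  infimum is taken over an empty family of paths.\<close>

lemma distance_set_eq:
  assumes "connected_graph G" "finite (vertices G)"
  shows "distance_set G l = insert 0 (edge_weight l ` edges G)"
proof -
  have G: "is_graph G"
    using assms(1) by (simp add: connected_graph_def)
  show ?thesis
  proof (intro equalityI subsetI)
    fix t
    assume "t \<in> distance_set G l"
    then obtain x y where xy: "t = label_dist G l x y" "x \<in> vertices G" "y \<in> vertices G"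
      unfolding distance_set_def by blast
    show "t \<in> insert 0 (edge_weight l ` edges G)"
    proof (cases "x = y")
      case True
      then show ?thesis
        using xy(1) by (simp add: label_dist_def)
    next
      case False
      then have "paths_between G x y \<noteq> {}"
        using assms(1) xy(2,3) unfolding connected_graph_def by blast
      then show ?thesis
        using label_dist_in_edge_weights[OF finite_edges[OF G assms(2)] _ False] xy(1) by blast
    qed
  next
    fix t
    assume "t \<in> insert 0 (edge_weight l ` edges G)"
    then consider "t = 0" | e where "e \<in> edges G" "t = edge_weight l e"
      by blast
    then show "t \<in> distance_set G l"
    proof cases
      case 1
      obtain x where "x \<in> vertices G"
        using G unfolding is_graph_def by blast
      moreover have "t = label_dist G l x x"
        using 1 by (simp add: label_dist_def)
      ultimately show ?thesis
        unfolding distance_set_def by blast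
    next
      case 2
      obtain x y where xy: "e = {x, y}" "x \<in> vertices G" "y \<in> vertices G" "x \<noteq> y"
        using is_graph_edgeE[OF G 2(1)] by blast
      then have "t = label_dist G l x y"
        using label_dist_adjacent[OF G] 2 by simp
      then show ?thesis
        using xy unfolding distance_set_def by blast
    qed
  qed
qed

section \<open>Cycles and repeated edge weights\<close>

lemma cycle_edge_weight_not_inj:
  assumes "is_cycle C" "subgraph C G"
  shows "\<not> inj_on (edge_weight l) (edges G)"
proof
  assume inj: "inj_on (edge_weight l) (edges G)"
  obtain xs where dist: "distinct xs" and len: "3 \<le> length xs"
    and C: "edges C = {{xs ! i, xs ! Suc i} | i. Suc i < length xs} \<union> {{last xs, hd xs}}"
    using assms(1) unfolding is_cycle_def by blast
  have ends: "last xs = xs ! (length xs - 1)" "hd xs = xs ! 0"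
    using len by (cases xs; simp add: last_conv_nth)+
  have step: "{xs ! i, xs ! Suc i} \<in> edges G" if "Suc i < length xs" for i
    using that C assms(2) unfolding subgraph_def by blast
  have wrap: "{xs ! (length xs - 1), xs ! 0} \<in> edges G"
    using C assms(2) ends unfolding subgraph_def by auto
  have "Max (l ` set xs) \<in> l ` set xs"
    using len by (intro Max_in) auto
  then obtain i where i: "i < length xs" "l (xs ! i) = Max (l ` set xs)"
    by (auto simp: in_set_conv_nth)
  have le: "l (xs ! k) \<le> l (xs ! i)" if "k < length xs" for k
    using that i(2) by simp
  \<comment> \<open>\<open>p\<close> and \<open>q\<close> are the cyclic successor and predecessor
    of \<open>i\<close>; they differ because the cycle has at least three vertices.\<close>
  define p where "p = (if Suc i < length xs then Suc i else 0)"
  define q where "q = (if i = 0 then length xs - 1 else i - 1)"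
  have pq: "p < length xs" "q < length xs" "p \<noteq> q" "p \<noteq> i" "q \<noteq> i"
    using i(1) len by (auto simp: p_def q_def split: if_splits)
  have "{xs ! i, xs ! p} \<in> edges G"
  proof (cases "Suc i < length xs")
    case False
    then have "i = length xs - 1"
      using i(1) by simp
    then show ?thesis
      using False wrap by (simp add: p_def)
  qed (simp add: p_def step)
  moreover have "{xs ! i, xs ! q} \<in> edges G"
    using step[of "i - 1"] i(1) wrap by (cases i) (auto simp: q_def insert_commute)
  \<comment> \<open>Both weights equal the maximal label \<open>l (xs ! i)\<close>.\<close>
  moreover have "edge_weight l {xs ! i, xs ! p} = edge_weight l {xs ! i, xs ! q}"
    using le[OF pq(1)] le[OF pq(2)] by simp
  ultimately have "{xs ! i, xs ! p} = {xs ! i, xs ! q}"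
    using inj by (metis inj_onD)
  then show False
    using pq i(1) dist by (auto simp: doubleton_eq_iff nth_eq_iff_index_eq)
qed

section \<open>Labelings of acyclic graphs\<close>

text \<open>The first vertex of a longest path works: a neighbour off the path would extend it, and
  a neighbour beyond the second position would close a cycle.\<close>

lemma acyclic_ex_low_degree:
  assumes fin: "finite V" and ne: "V \<noteq> {}"
    and E: "E \<subseteq> {{x, y} | x y. x \<in> V \<and> y \<in> V \<and> x \<noteq> y}"
    and acyc: "\<And>C. is_cycle C \<Longrightarrow> \<not> subgraph C (V, E)"
  obtains v u where "v \<in> V" "\<And>e. e \<in> E \<Longrightarrow> v \<in> e \<Longrightarrow> e = {v, u}"
proof -
  define path where "path xs \<longleftrightarrow> distinct xs \<and> set xs \<subseteq> V \<and> xs \<noteq> [] \<and>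
    (\<forall>i. Suc i < length xs \<longrightarrow> {xs ! i, xs ! Suc i} \<in> E)" for xs
  obtain v0 where "v0 \<in> V"
    using ne by blast
  then have "path [v0]"
    by (simp add: path_def)
  moreover have "length xs < Suc (card V)" if "path xs" for xs
    using that fin unfolding path_def by (metis card_mono distinct_card less_Suc_eq_le)
  ultimately obtain xs where xs: "path xs" and longest: "\<And>ys. path ys \<Longrightarrow> length ys \<le> length xs"
    using ex_has_greatest_nat[of path "[v0]" length "Suc (card V)"] by blast
  then have ne_xs: "xs \<noteq> []" and dist: "distinct xs" and sub: "set xs \<subseteq> V"
    and step: "\<And>i. Suc i < length xs \<Longrightarrow> {xs ! i, xs ! Suc i} \<in> E"
    by (auto simp: path_def)
  define v where "v = hd xs"
  have v: "v = xs ! 0" "v \<in> V"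
    using ne_xs sub by (auto simp: v_def hd_conv_nth)
  \<comment> \<open>If the longest path is a single vertex, \<open>xs ! 1\<close> is unspecified,
    but then no edge contains \<open>v\<close>.\<close>
  have "e = {v, xs ! 1}" if e: "e \<in> E" "v \<in> e" for e
  proof -
    obtain y where y: "e = {v, y}" "y \<in> V" "y \<noteq> v"
      using e E by blast
    have "y \<in> set xs"
    proof (rule ccontr)
      assume y': "y \<notin> set xs"
      have "{(y # xs) ! i, (y # xs) ! Suc i} \<in> E" if "Suc i < length (y # xs)" for i
        using that step e(1) y(1) v(1) by (cases i) (auto simp: insert_commute)
      then have "path (y # xs)"
        using y' y(2) dist sub by (auto simp: path_def)
      then show False
        using longest[of "y # xs"] by simp
    qed
    then obtain j where j: "j < length xs" "y = xs ! j"
      by (auto simp: in_set_conv_nth)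
    have "j = 1"
    proof (rule ccontr)
      assume "j \<noteq> 1"
      moreover have "j \<noteq> 0"
        using j(2) y(3) v(1) by metis
      ultimately have j2: "2 \<le> j"
        by simp
      \<comment> \<open>The initial segment from \<open>v\<close> to \<open>y\<close> has at least
        three vertices, and \<open>e\<close> closes it to a cycle.\<close>
      define zs where "zs = take (Suc j) xs"
      have len: "length zs = Suc j"
        using j(1) by (simp add: zs_def)
      have ends: "last zs = y" "hd zs = v"
        using j ne_xs by (simp_all add: zs_def take_Suc_conv_app_nth v_def hd_append hd_conv_nth)
      let ?C = "(set zs, {{zs ! i, zs ! Suc i} | i. Suc i < length zs} \<union> {{last zs, hd zs}})"
      have "is_cycle ?C"
        unfolding is_cycle_def using len j2 dist by (intro exI[of _ zs]) (simp add: zs_def)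
      moreover have "{zs ! i, zs ! Suc i} \<in> E" if "Suc i < length zs" for i
        using that step[of i] j(1) len by (simp add: zs_def)
      moreover have "{last zs, hd zs} \<in> E"
        using ends e(1) y(1) by (simp add: insert_commute)
      moreover have "set zs \<subseteq> V"
        using sub set_take_subset unfolding zs_def by fast
      ultimately show False
        using acyc[of ?C] by (auto simp: subgraph_def)
    qed
    then show ?thesis
      using j y(1) by simp
  qed
  then show thesis
    using that v(2) by blast
qed

text \<open>Acyclicity is inherited when a vertex is removed, and allowing \<open>V\<close> to be
  empty gives the base of the induction. Positive labels are demanded so that no edge weight
  coincides with the distance 0.\<close>

lemma acyclic_ex_inj_labeling:
  assumes "finite V" "E \<subseteq> {{x, y} | x y. x \<in> V \<and> y \<in> V \<and> x \<noteq> y}"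
    and "\<And>C. is_cycle C \<Longrightarrow> \<not> subgraph C (V, E)"
  shows "\<exists>l. (\<forall>v\<in>V. 0 < l v) \<and> inj_on (edge_weight l) E"
  using assms
proof (induction "card V" arbitrary: V E rule: less_induct)
  case less
  show ?case
  proof (cases "V = {}")
    case True
    then show ?thesis
      using less.prems(2) by auto
  next
    case False
    obtain v u where v: "v \<in> V" and vu: "\<And>e. e \<in> E \<Longrightarrow> v \<in> e \<Longrightarrow> e = {v, u}"
      using acyclic_ex_low_degree[OF less.prems(1) False less.prems(2,3)] by blast
    define V' where "V' = V - {v}"
    define E' where "E' = {e \<in> E. v \<notin> e}"
    have "\<exists>x y. e = {x, y} \<and> x \<in> V' \<and> y \<in> V' \<and> x \<noteq> y" if e: "e \<in> E'" for e
    proof -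
      obtain x y where "e = {x, y}" "x \<in> V" "y \<in> V" "x \<noteq> y"
        using e less.prems(2) unfolding E'_def by blast
      then show ?thesis
        using e unfolding V'_def E'_def by blast
    qed
    then have V'E': "finite V'" "E' \<subseteq> {{x, y} | x y. x \<in> V' \<and> y \<in> V' \<and> x \<noteq> y}"
      using less.prems(1) unfolding V'_def by auto
    have "card V' < card V"
      using v less.prems(1) unfolding V'_def by (rule card_Diff1_less[rotated])
    moreover have "\<not> subgraph C (V', E')" if "is_cycle C" for C
      using less.prems(3)[OF that] unfolding subgraph_def V'_def E'_def by auto
    ultimately obtain l where pos: "\<forall>x\<in>V'. 0 < l x" and inj: "inj_on (edge_weight l) E'"
      using less.hyps[of V' E'] V'E' by blast
    \<comment> \<open>Inserting 0 makes the maximum meaningful for empty \<open>V'\<close> and makes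
      \<open>m\<close> positive.\<close>
    define m where "m = Max (insert 0 (l ` V')) + 1"
    have "t < m" if "t \<in> insert 0 (l ` V')" for t
      using Max_ge[OF _ that] V'E'(1) unfolding m_def by fastforce
    then have m: "0 < m" "\<And>x. x \<in> V' \<Longrightarrow> l x < m"
      by auto
    define l' where "l' = l(v := m)"
    have old: "edge_weight l' e = edge_weight l e \<and> edge_weight l' e < m" if e: "e \<in> E'" for e
    proof -
      obtain x y where "e = {x, y}" "x \<in> V'" "y \<in> V'"
        using e V'E'(2) by blast
      then show ?thesis
        using m(2) by (auto simp: l'_def V'_def)
    qed
    \<comment> \<open>At most one edge is new, and its weight exceeds all old ones, so injectivity
      survives.\<close>
    have new: "e = {v, u} \<and> m \<le> edge_weight l' e" if "e \<in> E - E'" for e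
      using that vu[of e] by (auto simp: E'_def l'_def)
    have "inj_on (edge_weight l') E"
    proof (rule inj_onI)
      fix e f
      assume "e \<in> E" "f \<in> E" "edge_weight l' e = edge_weight l' f"
      then show "e = f"
        using old[of e] old[of f] new[of e] new[of f] inj
        by (cases "e \<in> E'"; cases "f \<in> E'") (auto dest: inj_onD)
    qed
    moreover have "\<forall>x\<in>V. 0 < l' x"
      using pos m(1) by (auto simp: l'_def V'_def)
    ultimately show ?thesis
      by blast
  qed
qed

theorem theorem3p10:
  fixes G :: "'a graph"
  assumes "is_graph G" and "finite (vertices G)" and "connected_graph G"
  shows "(\<forall>l\<in>labelings G. card (distance_set G l) \<le> card (edges G) + 1) \<and>
         ((\<exists>l\<in>labelings G. card (distance_set G l) = card (edges G) + 1) \<longleftrightarrow> is_tree G)"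
proof -
  note D = distance_set_eq[OF assms(3,2)]
  have fin: "finite (edges G)"
    using assms(1,2) by (rule finite_edges)
  have image_le: "card (edge_weight l ` edges G) \<le> card (edges G)" for l
    using fin by (rule card_image_le)
  have bound: "card (distance_set G l) \<le> card (edges G) + 1" for l
    using image_le[of l] fin unfolding D by (simp add: card_insert_if)
  show ?thesis
  proof (intro conjI ballI iffI)
    show "card (distance_set G l) \<le> card (edges G) + 1" for l
      by (rule bound)
  next
    assume "\<exists>l\<in>labelings G. card (distance_set G l) = card (edges G) + 1"
    then obtain l where "card (distance_set G l) = card (edges G) + 1"
      by blast
    \<comment> \<open>Were 0 an edge weight, there would be at most \<open>card (edges G)\<close>
      distances; so 0 is an extra element and the weights are as many as the edges.\<close>
    then have "card (edge_weight l ` edges G) = card (edges G)"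
      using image_le[of l] fin unfolding D by (simp add: card_insert_if split: if_splits)
    then have "inj_on (edge_weight l) (edges G)"
      using fin by (rule eq_card_imp_inj_on[rotated])
    then show "is_tree G"
      using assms(3) cycle_edge_weight_not_inj unfolding is_tree_def by blast
  next
    assume "is_tree G"
    then obtain l where pos: "\<forall>v\<in>vertices G. 0 < l v" and inj: "inj_on (edge_weight l) (edges G)"
      using acyclic_ex_inj_labeling[of "vertices G" "edges G"] assms(1,2)
      unfolding is_tree_def is_graph_def by auto
    \<comment> \<open>Positivity makes 0 a further distance, which accounts for the
      \<open>+ 1\<close>.\<close>
    have "0 < edge_weight l e" if "e \<in> edges G" for e
      using is_graph_edgeE[OF assms(1) that] pos by (metis edge_weight_doubleton less_max_iff_disj)
    then have "0 \<notin> edge_weight l ` edges G"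
      by force
    then have "card (distance_set G l) = card (edges G) + 1"
      using fin inj unfolding D by (simp add: card_image)
    moreover have "l \<in> labelings G"
      using pos unfolding labelings_def by force
    ultimately show "\<exists>l\<in>labelings G. card (distance_set G l) = card (edges G) + 1"
      by blast
  qed
qed

end
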